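(* Let $n\ge 1$ and let $A,B,X\in\mathbb{M}_n(\mathbb{C})$ with $X$ Hermitian be such that the block matrix $\begin{bmatrix} A & X\\ X & B\end{bmatrix}\in\mathbb{M}_{2n}(\mathbb{C})$ is positive semidefinite. Then there exist isometries $U,V\in\mathbb{M}_{2n,n}(\mathbb{C})$ such that $$\begin{bmatrix} A & X\\ X & B\end{bmatrix}=\frac{1}{2}\left\{U(A+B)U^*+V(A+B)V^*\right\}.$$
   Context: $\mathbb{M}_n(\mathbb{C})$ is the algebra of $n\times n$ complex matrices. $\mathbb{M}_{p,q}(\mathbb{C})$ is the space of complex matrices with $p$ rows and $q$ columns; $V\in\mathbb{M}_{p,q}(\mathbb{C})$ is an isometry if $p\ge q$ and $V^*V=I_q$. *)

theory Defs
  imports "Jordan_Normal_Form.Schur_Decomposition"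
begin

text \<open>The equation forces the matrix to be square, since the adjoint swaps the two dimensions.\<close>

definition hermitian_mat :: "complex mat \<Rightarrow> bool" where
  "hermitian_mat M \<longleftrightarrow> mat_adjoint M = M"

text \<open>The form below is $v^* M v$.  In the order on the complex numbers used here,
  \<open>0 \<le> z\<close> means that \<open>z\<close> is real and nonnegative.\<close>

definition psd_mat :: "complex mat \<Rightarrow> bool" where
  "psd_mat M \<longleftrightarrow>
     hermitian_mat M \<and> (\<forall>v \<in> carrier_vec (dim_row M). 0 \<le> (M *\<^sub>v v) \<bullet>c v)"

definition isometry_mat :: "complex mat \<Rightarrow> bool" where
  "isometry_mat V \<longleftrightarrow>
     dim_col V \<le> dim_row V \<and> mat_adjoint V * V = 1\<^sub>m (dim_col V)"

end

theory Submission
  imports Defs "Jordan_Normal_Form.Spectral_Radius"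
begin

text \<open>
  Write \<open>H\<close> for the positive block matrix and, for \<open>\<epsilon> = \<plusminus>\<i>\<close>, let \<open>C\<^sub>\<epsilon>\<close> be the \<open>2n \<times> n\<close> matrix
  with the identity on top of \<open>\<epsilon>\<close> times the identity.  Two facts about these columns carry
  the proof.  Compressing by one of them gives
  \<open>C\<^sub>\<epsilon>\<^sup>* H C\<^sub>\<epsilon> = A + \<epsilon> X + cnj \<epsilon> X + B = A + B\<close>: the off-diagonal blocks are equal and
  \<open>\<epsilon>\<close> is purely imaginary, so they cancel (\<open>phase_col_compress\<close>).  Together they resolve the
  identity, \<open>C\<^sub>\<epsilon> C\<^sub>\<epsilon>\<^sup>*\<close> summed over both signs being twice the identity
  (\<open>phase_col_resolution\<close>).

  Now let \<open>R\<close> be a Hermitian square root of \<open>H\<close> and \<open>P\<^sub>\<epsilon> = R C\<^sub>\<epsilon>\<close>.  The resolution of the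
  identity makes \<open>P\<^sub>\<epsilon> P\<^sub>\<epsilon>\<^sup>*\<close> sum to \<open>R (2 I) R = 2 H\<close>, while each \<open>P\<^sub>\<epsilon>\<^sup>* P\<^sub>\<epsilon>\<close> is the compression
  \<open>A + B\<close>.  The polar decomposition \<open>P\<^sub>\<epsilon> = U T\<close>, with \<open>U\<close> an isometry and \<open>T\<close> Hermitian, turns
  one product into the other: \<open>P\<^sub>\<epsilon> P\<^sub>\<epsilon>\<^sup>* = U T\<^sup>2 U\<^sup>*\<close> and \<open>P\<^sub>\<epsilon>\<^sup>* P\<^sub>\<epsilon> = T\<^sup>2\<close>
  (\<open>gram_exchange\<close>).  Halving the sum gives the decomposition.

  The square root and the polar decomposition both come from an orthonormal eigenbasis of a
  Hermitian matrix.  That basis, and the completion of the singular vectors of \<open>P\<^sub>\<epsilon>\<close> to a full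
  isometry, rest on one tool: an orthonormal family can be extended as long as its size stays
  within the dimension (\<open>orthonormal_on_extend\<close>).
\<close>

section \<open>The adjoint\<close>

lemma index_mat_adjoint [simp]:
  "i < dim_col A \<Longrightarrow> j < dim_row A \<Longrightarrow> mat_adjoint A $$ (i, j) = conjugate (A $$ (j, i))"
  unfolding mat_adjoint_def by (simp add: mat_of_rows_index)

lemma dim_mat_adjoint [simp]:
  "dim_row (mat_adjoint A) = dim_col A" "dim_col (mat_adjoint A) = dim_row A"
  unfolding mat_adjoint_def by auto

lemma mat_adjoint_carrier [simp]:
  "A \<in> carrier_mat m n \<Longrightarrow> mat_adjoint A \<in> carrier_mat n m"
  by (metis carrier_matD carrier_matI dim_mat_adjoint)

lemma mat_adjoint_mat_adjoint [simp]: "mat_adjoint (mat_adjoint A) = A"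
  by (rule eq_matI) auto

lemma mat_adjoint_mult:
  fixes A B :: "complex mat"
  assumes "A \<in> carrier_mat m n" "B \<in> carrier_mat n k"
  shows "mat_adjoint (A * B) = mat_adjoint B * mat_adjoint A"
  using assms by (intro eq_matI) (auto simp: scalar_prod_def mult.commute)

lemma mult_mat_vec_cscalar_prod:
  fixes A :: "complex mat"
  assumes A: "A \<in> carrier_mat m n" and v: "v \<in> carrier_vec n" and w: "w \<in> carrier_vec m"
  shows "(A *\<^sub>v v) \<bullet>c w = v \<bullet>c (mat_adjoint A *\<^sub>v w)"
proof -
  have eq: "conjugate (mat_adjoint A *\<^sub>v w) = transpose_mat A *\<^sub>v conjugate w"
    using A w by (intro eq_vecI) (auto simp: scalar_prod_def)
  have "(transpose_mat A *\<^sub>v conjugate w) \<bullet> v = conjugate w \<bullet> (A *\<^sub>v v)"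
    by (rule transpose_vec_mult_scalar[OF A v]) (use w in simp)
  moreover have "conjugate w \<bullet> (A *\<^sub>v v) = (A *\<^sub>v v) \<bullet>c w"
    by (rule comm_scalar_prod[of _ m]) (use A v w in auto)
  moreover have "(transpose_mat A *\<^sub>v conjugate w) \<bullet> v = v \<bullet> (transpose_mat A *\<^sub>v conjugate w)"
    by (rule comm_scalar_prod[of _ n]) (use A v w in auto)
  ultimately show ?thesis
    unfolding eq by simp
qed

lemma isometry_mat_unitary:
  assumes Q: "Q \<in> carrier_mat n n" and iso: "isometry_mat Q"
  shows "Q * mat_adjoint Q = 1\<^sub>m n"
  by (rule mat_mult_left_right_inverse[of "mat_adjoint Q"])
    (use Q iso in \<open>auto simp: isometry_mat_def\<close>)

lemma isometry_mat_mult_unitary: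
  assumes W: "W \<in> carrier_mat m n" and Q: "Q \<in> carrier_mat n n"
    and isoW: "isometry_mat W" and isoQ: "isometry_mat Q"
  shows "isometry_mat (W * mat_adjoint Q)"
proof -
  have a: "mat_adjoint (W * mat_adjoint Q) = Q * mat_adjoint W"
    using mat_adjoint_mult[OF W mat_adjoint_carrier[OF Q]] by simp
  have WW: "mat_adjoint W * W = 1\<^sub>m n"
    using isoW W by (auto simp: isometry_mat_def)
  have "(Q * mat_adjoint W) * (W * mat_adjoint Q) = Q * ((mat_adjoint W * W) * mat_adjoint Q)"
    using W Q by (simp add: assoc_mult_mat[of _ n m _ n _ n] assoc_mult_mat[of _ n n _ m _ n])
  also have "\<dots> = 1\<^sub>m n"
    unfolding WW using Q isometry_mat_unitary[OF Q isoQ] by simp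
  finally show ?thesis
    using W Q isoW by (auto simp: isometry_mat_def a)
qed

section \<open>Extending orthonormal families\<close>

text \<open>
  The index set is arbitrary because the normalized singular vectors in the polar decomposition
  are available only at the indices of nonzero singular values, which need not be an initial
  segment.
\<close>

definition orthonormal_on :: "nat set \<Rightarrow> nat \<Rightarrow> (nat \<Rightarrow> complex vec) \<Rightarrow> bool" where
  "orthonormal_on I m u \<longleftrightarrow>
     (\<forall>i\<in>I. u i \<in> carrier_vec m) \<and>
     (\<forall>i\<in>I. \<forall>j\<in>I. u i \<bullet>c u j = (if i = j then 1 else 0))"

lemma cscalar_prod_commute:
  fixes v w :: "complex vec"
  assumes "v \<in> carrier_vec m" "w \<in> carrier_vec m"
  shows "w \<bullet>c v = cnj (v \<bullet>c w)"
  using assms by (auto simp: scalar_prod_def mult.commute)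

text \<open>
  The conjugates of the vectors of \<open>S\<close> are taken as rows of an \<open>m \<times> m\<close> matrix, padded with zero
  rows.  At least one row is zero, so the matrix is singular, and a vector in its kernel is
  orthogonal to all of \<open>S\<close>.
\<close>

lemma exists_orthogonal_vec:
  fixes S :: "complex vec set"
  assumes S: "finite S" "S \<subseteq> carrier_vec m" "card S < m"
  obtains w where "w \<in> carrier_vec m" "w \<noteq> 0\<^sub>v m" "\<And>s. s \<in> S \<Longrightarrow> w \<bullet>c s = 0"
proof -
  obtain ss where ss: "set ss = S" "distinct ss"
    using finite_distinct_list[OF S(1)] by blast
  have len: "length ss < m"
    using S(3) ss distinct_card by metis
  define r where "r i = (if i < length ss then conjugate (ss ! i) else 0\<^sub>v m)" for i
  have r: "r i \<in> carrier_vec m" for i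
  proof (cases "i < length ss")
    case True
    hence "ss ! i \<in> carrier_vec m" using nth_mem ss(1) S(2) by blast
    thus ?thesis using True by (simp add: r_def)
  qed (simp add: r_def)
  \<comment> \<open>Row \<open>m - 1\<close> is past the end of \<open>ss\<close>, so prescribing it to be zero changes nothing.\<close>
  define M where "M = mat\<^sub>r m m (\<lambda>i. if i = m - 1 then 0\<^sub>v m else r i)"
  have M: "M \<in> carrier_mat m m" by (simp add: M_def)
  have "det M = 0"
    unfolding M_def by (rule det_row_0) (use len r in auto)
  then obtain w where w: "w \<in> carrier_vec m" "w \<noteq> 0\<^sub>v m" "M *\<^sub>v w = 0\<^sub>v m"
    using det_0_iff_vec_prod_zero_field[OF M] by blast
  have "w \<bullet>c s = 0" if sS: "s \<in> S" for s
  proof -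
    obtain i where i: "i < length ss" "s = ss ! i"
      using sS ss(1) in_set_conv_nth[of s ss] by blast
    have s: "s \<in> carrier_vec m" using sS S by auto
    have im: "i < m" "i \<noteq> m - 1" using i(1) len by auto
    have "row M i = r i"
      unfolding M_def using im r[of i] by (subst row_mat_of_row_fun) auto
    hence "(M *\<^sub>v w) $ i = conjugate s \<bullet> w"
      using i im(1) carrier_matD[OF M] by (simp add: r_def)
    also have "\<dots> = w \<bullet>c s"
      by (rule comm_scalar_prod[of _ m]) (use s w in auto)
    finally have "(M *\<^sub>v w) $ i = w \<bullet>c s" .
    thus ?thesis using w(3) i len by simp
  qed
  with w that show thesis by blast
qed

lemma cscalar_prod_normalize:
  fixes w :: "complex vec"
  assumes w: "w \<in> carrier_vec m" "w \<noteq> 0\<^sub>v m"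
  obtains c :: real where "(of_real c \<cdot>\<^sub>v w) \<bullet>c (of_real c \<cdot>\<^sub>v w) = 1"
proof -
  define r where "r = Re (w \<bullet>c w)"
  have "w \<bullet>c w > 0"
    using w by simp
  hence r: "w \<bullet>c w = of_real r" "r > 0"
    by (auto simp: r_def less_complex_def complex_eq_iff)
  have "(of_real (1 / sqrt r) \<cdot>\<^sub>v w) \<bullet>c (of_real (1 / sqrt r) \<cdot>\<^sub>v w)
      = of_real (1 / sqrt r) * (of_real (1 / sqrt r) * (w \<bullet>c w))"
    using w by (auto simp: conjugate_smult_vec)
  also have "\<dots> = of_real (1 / sqrt r * (1 / sqrt r * r))"
    unfolding r(1) by (simp only: of_real_mult)
  also have "1 / sqrt r * (1 / sqrt r * r) = 1"
    using r(2) by (simp add: field_simps)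
  finally show thesis
    using that[of "1 / sqrt r"] by auto
qed

lemma orthonormal_on_insert:
  assumes u: "orthonormal_on I m u" and j: "j \<notin> I"
    and w: "w \<in> carrier_vec m" "w \<noteq> 0\<^sub>v m" "\<And>i. i \<in> I \<Longrightarrow> w \<bullet>c u i = 0"
  obtains c :: real where "orthonormal_on (insert j I) m (u(j := of_real c \<cdot>\<^sub>v w))"
proof -
  obtain c :: real where c: "(of_real c \<cdot>\<^sub>v w) \<bullet>c (of_real c \<cdot>\<^sub>v w) = 1"
    using cscalar_prod_normalize[OF w(1,2)] by blast
  let ?w = "of_real c \<cdot>\<^sub>v w"
  have ui: "u i \<in> carrier_vec m" if "i \<in> I" for i
    using u that by (auto simp: orthonormal_on_def)
  have 1: "?w \<bullet>c u i = 0" if "i \<in> I" for i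
    using w ui that by simp
  have 2: "u i \<bullet>c ?w = 0" if "i \<in> I" for i
    using cscalar_prod_commute[of ?w m "u i"] 1[OF that] w ui[OF that] by simp
  have "orthonormal_on (insert j I) m (u(j := ?w))"
    using u j c 1 2 w unfolding orthonormal_on_def by auto
  thus thesis by (rule that)
qed

text \<open>
  Induction on the set of new indices: each one receives a normalized vector orthogonal to those
  already chosen, of which there are fewer than \<open>m\<close>.
\<close>

lemma orthonormal_on_extend:
  assumes "finite J" and "orthonormal_on I m u" and "I \<subseteq> J" and "card J \<le> m"
  shows "\<exists>v. orthonormal_on J m v \<and> (\<forall>i\<in>I. v i = u i)"
proof -
  have "\<exists>v. orthonormal_on (I \<union> K) m v \<and> (\<forall>i\<in>I. v i = u i)" if "K \<subseteq> J - I" for K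
    using finite_subset[OF that finite_Diff[OF assms(1)]] that
  proof (induction K)
    case empty
    thus ?case using assms(2) by auto
  next
    case (insert j K)
    then obtain v where v: "orthonormal_on (I \<union> K) m v" "\<forall>i\<in>I. v i = u i"
      by auto
    have "I \<union> K \<subset> J" using insert assms by auto
    hence fin: "finite (I \<union> K)" and "card (I \<union> K) < card J"
      using assms(1) by (auto intro: psubset_card_mono dest: finite_subset)
    hence card: "card (v ` (I \<union> K)) < m"
      using card_image_le[OF fin, of v] assms(4) by linarith
    obtain w where w: "w \<in> carrier_vec m" "w \<noteq> 0\<^sub>v m" "\<And>s. s \<in> v ` (I \<union> K) \<Longrightarrow> w \<bullet>c s = 0"
      using exists_orthogonal_vec[of "v ` (I \<union> K)" m] fin card v(1)
      unfolding orthonormal_on_def by blast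
    have j: "j \<notin> I \<union> K" using insert by auto
    obtain c :: real where "orthonormal_on (insert j (I \<union> K)) m (v(j := of_real c \<cdot>\<^sub>v w))"
      using orthonormal_on_insert[OF v(1) j w(1,2)] w(3) by blast
    moreover have "\<forall>i\<in>I. (v(j := of_real c \<cdot>\<^sub>v w)) i = u i"
      using v(2) j by auto
    ultimately show ?case by (metis Un_insert_right)
  qed
  from this[of "J - I"] assms(3) show ?thesis
    by (simp add: Un_absorb1)
qed

definition mat_of_family :: "nat \<Rightarrow> nat \<Rightarrow> (nat \<Rightarrow> complex vec) \<Rightarrow> complex mat" where
  "mat_of_family m n u = mat m n (\<lambda>(i, j). u j $ i)"

lemma mat_of_family_carrier [simp]: "mat_of_family m n u \<in> carrier_mat m n"
  by (simp add: mat_of_family_def)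

lemma col_mat_of_family [simp]:
  "j < n \<Longrightarrow> u j \<in> carrier_vec m \<Longrightarrow> col (mat_of_family m n u) j = u j"
  by (auto simp: mat_of_family_def)

lemma orthonormal_on_isometry:
  assumes u: "orthonormal_on {..<n} m u" and nm: "n \<le> m"
  shows "isometry_mat (mat_of_family m n u)"
proof -
  have "(mat_adjoint (mat_of_family m n u) * mat_of_family m n u) $$ (i, j) = 1\<^sub>m n $$ (i, j)"
    if ij: "i < n" "j < n" for i j
  proof -
    have c: "u i \<in> carrier_vec m" "u j \<in> carrier_vec m"
      using u ij by (auto simp: orthonormal_on_def)
    have "(mat_adjoint (mat_of_family m n u) * mat_of_family m n u) $$ (i, j) = u j \<bullet>c u i"
      using ij c by (auto simp: mat_of_family_def scalar_prod_def mult.commute)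
    thus ?thesis
      using u ij by (auto simp: orthonormal_on_def)
  qed
  hence "mat_adjoint (mat_of_family m n u) * mat_of_family m n u = 1\<^sub>m n"
    by (intro eq_matI) (auto simp: mat_of_family_def)
  thus ?thesis
    using nm by (simp add: isometry_mat_def mat_of_family_def)
qed

text \<open>
  An orthonormal family of full size is a unitary matrix \<open>Q\<close>, so \<open>z = Q (Q\<^sup>* z)\<close>, and the entries
  of \<open>Q\<^sup>* z\<close> are the inner products assumed to vanish.
\<close>

lemma orthonormal_basis_separates:
  assumes u: "orthonormal_on {..<n} n u" and z: "z \<in> carrier_vec n"
    and zero: "\<And>i. i < n \<Longrightarrow> z \<bullet>c u i = 0"
  shows "z = 0\<^sub>v n"
proof -
  let ?Q = "mat_of_family n n u"
  have ui: "u i \<in> carrier_vec n" if "i < n" for i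
    using u that by (auto simp: orthonormal_on_def)
  have "(mat_adjoint ?Q *\<^sub>v z) $ i = z \<bullet>c u i" if "i < n" for i
    using that ui[OF that] z by (auto simp: mat_of_family_def scalar_prod_def mult.commute)
  hence "mat_adjoint ?Q *\<^sub>v z = 0\<^sub>v n"
    using zero by (intro eq_vecI) (auto simp: mat_of_family_def)
  moreover have "?Q *\<^sub>v (mat_adjoint ?Q *\<^sub>v z) = z"
    using isometry_mat_unitary[OF _ orthonormal_on_isometry[OF u]] z
    by (metis assoc_mult_mat_vec le_refl mat_adjoint_carrier mat_of_family_carrier one_mult_mat_vec)
  moreover have "?Q *\<^sub>v 0\<^sub>v n = 0\<^sub>v n"
    by (intro eq_vecI) (auto simp: mat_of_family_def scalar_prod_def)
  ultimately show ?thesis by simp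
qed

section \<open>Diagonalization, square roots and the polar decomposition\<close>

text \<open>
  The orthogonal complement of a family of eigenvectors of a Hermitian matrix is invariant, and
  the new eigenvector is found there.  The columns of \<open>W\<close> are an orthonormal basis of the
  complement, and \<open>G = W\<^sup>* H W\<close> is the restriction of \<open>H\<close> in that basis.  For an eigenvector
  \<open>y\<close> of \<open>G\<close>, the residual \<open>H W y - e W y\<close> is orthogonal to the complement by the choice of
  \<open>y\<close> and to the given eigenvectors because \<open>H\<close> is Hermitian; hence it vanishes.
\<close>

lemma exists_eigenvec_orthogonal:
  assumes H: "H \<in> carrier_mat n n" and herm: "hermitian_mat H"
    and u: "orthonormal_on {..<k} n u" and k: "k < n"
    and ev: "\<And>i. i < k \<Longrightarrow> H *\<^sub>v u i = d i \<cdot>\<^sub>v u i"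
  obtains w e where "w \<in> carrier_vec n" "w \<noteq> 0\<^sub>v n" "\<And>i. i < k \<Longrightarrow> w \<bullet>c u i = 0"
    "H *\<^sub>v w = e \<cdot>\<^sub>v w"
proof -
  obtain v where v: "orthonormal_on {..<n} n v" "\<And>i. i < k \<Longrightarrow> v i = u i"
    using orthonormal_on_extend[of "{..<n}" "{..<k}" n u] u k by auto
  have vc: "v i \<in> carrier_vec n" if "i < n" for i
    using v that by (auto simp: orthonormal_on_def)
  define W where "W = mat_of_family n (n - k) (\<lambda>i. v (k + i))"
  have W: "W \<in> carrier_mat n (n - k)" by (simp add: W_def)
  have "isometry_mat W"
    unfolding W_def using v(1) k
    by (intro orthonormal_on_isometry) (auto simp: orthonormal_on_def)
  hence WW: "mat_adjoint W * W = 1\<^sub>m (n - k)"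
    using W by (auto simp: isometry_mat_def)
  have Wad: "(mat_adjoint W *\<^sub>v x) $ a = x \<bullet>c v (k + a)"
    if "x \<in> carrier_vec n" "a < n - k" for x a
  proof -
    have "v (k + a) \<in> carrier_vec n" using vc that(2) by simp
    thus ?thesis
      using that by (auto simp: W_def mat_of_family_def scalar_prod_def mult.commute)
  qed
  define G where "G = mat_adjoint W * (H * W)"
  have G: "G \<in> carrier_mat (n - k) (n - k)"
    using W H by (auto simp: G_def)
  obtain e where "eigenvalue G e"
    using spectrum_non_empty[OF G] k by (auto simp: spectrum_def)
  then obtain y where y: "y \<in> carrier_vec (n - k)" "y \<noteq> 0\<^sub>v (n - k)" "G *\<^sub>v y = e \<cdot>\<^sub>v y"
    using G by (auto simp: eigenvalue_def eigenvector_def)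
  define w where "w = W *\<^sub>v y"
  have w: "w \<in> carrier_vec n" using W y by (simp add: w_def)
  have Ww: "mat_adjoint W *\<^sub>v w = y"
    using WW W y unfolding w_def
    by (subst assoc_mult_mat_vec[symmetric]) auto
  have WHw: "mat_adjoint W *\<^sub>v (H *\<^sub>v w) = e \<cdot>\<^sub>v y"
  proof -
    have "G *\<^sub>v y = mat_adjoint W *\<^sub>v ((H * W) *\<^sub>v y)"
      unfolding G_def
      by (rule assoc_mult_mat_vec[of _ "n - k" n _ "n - k"]) (use W H y in auto)
    also have "(H * W) *\<^sub>v y = H *\<^sub>v w"
      unfolding w_def by (rule assoc_mult_mat_vec[OF H W y(1)])
    finally show ?thesis using y(3) by simp
  qed
  have w0: "w \<noteq> 0\<^sub>v n"
  proof
    assume "w = 0\<^sub>v n"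
    moreover have "mat_adjoint W *\<^sub>v 0\<^sub>v n = 0\<^sub>v (n - k)"
      using W by (intro eq_vecI) (auto simp: scalar_prod_def)
    ultimately show False using Ww y by simp
  qed
  have orth: "w \<bullet>c v i = 0" if i: "i < k" for i
  proof -
    have "mat_adjoint W *\<^sub>v v i = 0\<^sub>v (n - k)"
      using Wad[OF vc, of i] v(1) i k W
      by (intro eq_vecI) (auto simp: orthonormal_on_def)
    moreover have "w \<bullet>c v i = y \<bullet>c (mat_adjoint W *\<^sub>v v i)"
      unfolding w_def by (rule mult_mat_vec_cscalar_prod[OF W y(1)]) (use vc i k in auto)
    ultimately show ?thesis using y by simp
  qed
  have Hw: "H *\<^sub>v w \<in> carrier_vec n" using H w by simp
  have zc: "(H *\<^sub>v w - e \<cdot>\<^sub>v w) \<bullet>c v i = (H *\<^sub>v w) \<bullet>c v i - e * (w \<bullet>c v i)" if "i < n" for i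
    using Hw w vc[OF that] by (subst minus_scalar_prod_distrib[of _ n]) auto
  have "H *\<^sub>v w - e \<cdot>\<^sub>v w = 0\<^sub>v n"
  proof (rule orthonormal_basis_separates[OF v(1)])
    show "H *\<^sub>v w - e \<cdot>\<^sub>v w \<in> carrier_vec n" using Hw w by simp
  next
    fix i assume i: "i < n"
    show "(H *\<^sub>v w - e \<cdot>\<^sub>v w) \<bullet>c v i = 0"
    proof (cases "i < k")
      case True
      have "(H *\<^sub>v w) \<bullet>c v i = w \<bullet>c (H *\<^sub>v v i)"
        using mult_mat_vec_cscalar_prod[OF H w vc[OF i]] herm by (simp add: hermitian_mat_def)
      also have "\<dots> = w \<bullet>c (d i \<cdot>\<^sub>v v i)"
        using ev[OF True] v(2)[OF True] by simp
      also have "\<dots> = 0"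
        using orth[OF True] w vc[OF i] by (simp add: conjugate_smult_vec)
      finally show ?thesis using zc[OF i] orth[OF True] by simp
    next
      case False
      then obtain a where a: "i = k + a" "a < n - k"
        using i by (metis add_diff_inverse_nat less_diff_conv add.commute)
      have "(H *\<^sub>v w) \<bullet>c v i = e * y $ a"
        using Wad[OF Hw a(2)] WHw a y by simp
      moreover have "w \<bullet>c v i = y $ a"
        using Wad[OF w a(2)] Ww a by simp
      ultimately show ?thesis using zc[OF i] by simp
    qed
  qed
  hence "H *\<^sub>v w = e \<cdot>\<^sub>v w"
  proof (intro eq_vecI)
    fix i assume z: "H *\<^sub>v w - e \<cdot>\<^sub>v w = 0\<^sub>v n" and i: "i < dim_vec (e \<cdot>\<^sub>v w)"
    hence "(H *\<^sub>v w - e \<cdot>\<^sub>v w) $ i = 0" using w by simp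
    thus "(H *\<^sub>v w) $ i = (e \<cdot>\<^sub>v w) $ i" using i w H by (simp del: index_mult_mat_vec)
  qed (use H w in auto)
  with w w0 orth v(2) show thesis
    using that by metis
qed

theorem hermitian_eigenbasis:
  assumes H: "H \<in> carrier_mat n n" and herm: "hermitian_mat H"
  obtains u d where "orthonormal_on {..<n} n u" "\<And>i. i < n \<Longrightarrow> H *\<^sub>v u i = d i \<cdot>\<^sub>v u i"
proof -
  have "\<exists>u d. orthonormal_on {..<k} n u \<and> (\<forall>i<k. H *\<^sub>v u i = d i \<cdot>\<^sub>v u i)" if "k \<le> n" for k
    using that
  proof (induction k)
    case 0
    show ?case by (simp add: orthonormal_on_def)
  next
    case (Suc k)
    then obtain u d where u: "orthonormal_on {..<k} n u"
      and ev: "\<And>i. i < k \<Longrightarrow> H *\<^sub>v u i = d i \<cdot>\<^sub>v u i" by auto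
    have "k < n" using Suc by simp
    from exists_eigenvec_orthogonal[OF H herm u this ev]
    obtain w e where w: "w \<in> carrier_vec n" "w \<noteq> 0\<^sub>v n" "\<And>i. i < k \<Longrightarrow> w \<bullet>c u i = 0"
      "H *\<^sub>v w = e \<cdot>\<^sub>v w" by blast
    obtain c :: real where
      c: "orthonormal_on (insert k {..<k}) n (u(k := of_real c \<cdot>\<^sub>v w))"
      using orthonormal_on_insert[OF u _ w(1,2)] w(3) by blast
    have "H *\<^sub>v (of_real c \<cdot>\<^sub>v w) = e \<cdot>\<^sub>v (of_real c \<cdot>\<^sub>v w)"
      using mult_mat_vec[OF H w(1)] w(4) by (simp add: smult_smult_assoc mult.commute)
    hence "\<forall>i<Suc k. H *\<^sub>v (u(k := of_real c \<cdot>\<^sub>v w)) i = (d(k := e)) i \<cdot>\<^sub>v (u(k := of_real c \<cdot>\<^sub>v w)) i"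
      using ev by (auto simp: less_Suc_eq)
    with c show ?case
      unfolding lessThan_Suc by blast
  qed
  from this[of n] that show thesis by auto
qed

text \<open>
  The eigenvalues are nonnegative because they are the values of the quadratic form at unit
  eigenvectors.  They are given as squares since both applications, the square root and the
  polar decomposition, work with the roots \<open>s\<close>.
\<close>

lemma psd_mat_diagonalization:
  assumes K: "K \<in> carrier_mat n n" and psd: "psd_mat K"
  obtains Q and s :: "nat \<Rightarrow> real" where "Q \<in> carrier_mat n n" "isometry_mat Q"
    "K * Q = Q * mat_diag n (\<lambda>i. of_real (s i) * of_real (s i))"
proof -
  obtain u d where u: "orthonormal_on {..<n} n u" and ev: "\<And>i. i < n \<Longrightarrow> K *\<^sub>v u i = d i \<cdot>\<^sub>v u i"
    using hermitian_eigenbasis[OF K] psd unfolding psd_mat_def by blast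
  have uc: "u i \<in> carrier_vec n" if "i < n" for i
    using u that by (auto simp: orthonormal_on_def)
  define Q where "Q = mat_of_family n n u"
  define s where "s i = sqrt (Re (d i))" for i
  have d: "d i = of_real (s i) * of_real (s i)" if i: "i < n" for i
  proof -
    have "0 \<le> (K *\<^sub>v u i) \<bullet>c u i"
      using psd uc[OF i] K by (auto simp: psd_mat_def)
    also have "(K *\<^sub>v u i) \<bullet>c u i = d i"
      using ev[OF i] uc[OF i] u i by (simp add: orthonormal_on_def)
    finally have "Re (d i) \<ge> 0" "Im (d i) = 0"
      by (auto simp: less_eq_complex_def)
    thus ?thesis by (simp add: complex_eq_iff s_def)
  qed
  have "(K * Q) $$ (i, j) = (Q * mat_diag n (\<lambda>i. of_real (s i) * of_real (s i))) $$ (i, j)"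
    if ij: "i < n" "j < n" for i j
  proof -
    have "(K * Q) $$ (i, j) = (K *\<^sub>v u j) $ i"
      using ij uc[OF ij(2)] K by (simp add: Q_def carrier_matD[OF mat_of_family_carrier])
    also have "\<dots> = d j * u j $ i"
      using ev[OF ij(2)] uc[OF ij(2)] ij by simp
    also have "\<dots> = (Q * mat_diag n (\<lambda>i. of_real (s i) * of_real (s i))) $$ (i, j)"
      using ij d by (subst mat_diag_mult_right[of _ n]) (auto simp: Q_def mat_of_family_def)
    finally show ?thesis .
  qed
  hence "K * Q = Q * mat_diag n (\<lambda>i. of_real (s i) * of_real (s i))"
    using K by (intro eq_matI) (auto simp: Q_def mat_of_family_def mat_diag_def)
  moreover have "isometry_mat Q"
    unfolding Q_def by (rule orthonormal_on_isometry[OF u]) simp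
  ultimately show thesis
    using that[of Q s] by (simp add: Q_def)
qed

lemma mat_adjoint_diag_real:
  "mat_adjoint (mat_diag n (\<lambda>i. of_real (s i) :: complex)) = mat_diag n (\<lambda>i. of_real (s i))"
  by (rule eq_matI) (auto simp: mat_diag_def)

lemma mat_adjoint_conjugation:
  fixes Q D :: "complex mat"
  assumes "Q \<in> carrier_mat n n" "D \<in> carrier_mat n n" "mat_adjoint D = D"
  shows "mat_adjoint (Q * D * mat_adjoint Q) = Q * D * mat_adjoint Q"
  using assms mat_adjoint_mult[of "Q * D" n n "mat_adjoint Q" n] mat_adjoint_mult[of Q n n D n]
  by (simp add: assoc_mult_mat[of _ n n _ n _ n])

theorem psd_mat_sqrt:
  assumes K: "K \<in> carrier_mat n n" and psd: "psd_mat K"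
  obtains R where "R \<in> carrier_mat n n" "mat_adjoint R = R" "R * R = K"
proof -
  obtain Q and s :: "nat \<Rightarrow> real" where Q: "Q \<in> carrier_mat n n" "isometry_mat Q"
    and KQ: "K * Q = Q * mat_diag n (\<lambda>i. of_real (s i) * of_real (s i))"
    using psd_mat_diagonalization[OF K psd] .
  define D where "D = mat_diag n (\<lambda>i. of_real (s i) :: complex)"
  have D: "D \<in> carrier_mat n n" by (simp add: D_def)
  define E where "E = mat_adjoint Q"
  have E: "E \<in> carrier_mat n n" using Q by (simp add: E_def)
  have QQ: "E * Q = 1\<^sub>m n" "Q * E = 1\<^sub>m n"
    using Q isometry_mat_unitary[OF Q] by (auto simp: isometry_mat_def E_def)
  define R where "R = Q * D * E"
  have R: "R \<in> carrier_mat n n" using Q(1) D E unfolding R_def by (intro mult_carrier_mat)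
  have "R * R = Q * D * (E * Q) * D * E"
    using Q D E by (simp add: R_def assoc_mult_mat[of _ n n _ n _ n])
  also have "\<dots> = Q * (D * D) * E"
    unfolding QQ using Q D E by (simp add: assoc_mult_mat[of _ n n _ n _ n])
  also have "\<dots> = K * Q * E"
    by (simp add: KQ D_def)
  also have "\<dots> = K"
    using K Q E QQ by (simp add: assoc_mult_mat[of _ n n _ n _ n])
  finally show thesis
    using that[OF R] mat_adjoint_conjugation[OF Q(1) D] by (simp add: R_def D_def E_def mat_adjoint_diag_real)
qed

lemma psd_mat_gram:
  assumes P: "P \<in> carrier_mat m n"
  shows "psd_mat (mat_adjoint P * P)"
proof -
  have "0 \<le> (mat_adjoint P * P *\<^sub>v v) \<bullet>c v" if v: "v \<in> carrier_vec n" for v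
  proof -
    have "(mat_adjoint P * P *\<^sub>v v) \<bullet>c v = (mat_adjoint P *\<^sub>v (P *\<^sub>v v)) \<bullet>c v"
      using assoc_mult_mat_vec[OF mat_adjoint_carrier[OF P] P v] by simp
    also have "\<dots> = (P *\<^sub>v v) \<bullet>c (P *\<^sub>v v)"
      using mult_mat_vec_cscalar_prod[OF mat_adjoint_carrier[OF P], of "P *\<^sub>v v" v] P v by simp
    finally show ?thesis using P v by auto
  qed
  thus ?thesis
    using P mat_adjoint_mult[OF mat_adjoint_carrier[OF P] P]
      mult_carrier_mat[OF mat_adjoint_carrier[OF P] P]
    by (auto simp: psd_mat_def hermitian_mat_def)
qed

text \<open>
  Diagonalize \<open>P\<^sup>* P\<close> by a unitary \<open>Q\<close>.  The columns of \<open>P Q\<close> are then pairwise orthogonal with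
  lengths \<open>\<bar>s i\<bar>\<close>.  Dividing the nonzero ones by \<open>s i\<close> gives an orthonormal family; extended to
  all \<open>n\<close> indices, which \<open>n \<le> m\<close> allows, it is an isometry \<open>W\<close> with \<open>P Q = W D\<close> for
  \<open>D = diag s\<close>.  So \<open>P = W D Q\<^sup>* = (W Q\<^sup>*) (Q D Q\<^sup>*)\<close>.
\<close>

theorem polar_decomposition:
  assumes P: "P \<in> carrier_mat m n" and nm: "n \<le> m"
  obtains U T where "U \<in> carrier_mat m n" "T \<in> carrier_mat n n"
    "isometry_mat U" "mat_adjoint T = T" "P = U * T"
proof -
  define K where "K = mat_adjoint P * P"
  have K: "K \<in> carrier_mat n n"
    unfolding K_def by (rule mult_carrier_mat[OF mat_adjoint_carrier[OF P] P])
  obtain Q and s :: "nat \<Rightarrow> real" where Q: "Q \<in> carrier_mat n n" "isometry_mat Q"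
    and KQ: "K * Q = Q * mat_diag n (\<lambda>i. of_real (s i) * of_real (s i))"
    using psd_mat_diagonalization[OF K] psd_mat_gram[OF P] unfolding K_def by blast
  have QQ: "mat_adjoint Q * Q = 1\<^sub>m n" "Q * mat_adjoint Q = 1\<^sub>m n"
    using Q isometry_mat_unitary[OF Q] by (auto simp: isometry_mat_def)
  define w where "w i = col (P * Q) i" for i
  have wc: "w i \<in> carrier_vec m" if "i < n" for i
    using P Q that by (auto simp: w_def)
  have "mat_adjoint (P * Q) * (P * Q) = mat_adjoint Q * (K * Q)"
    using P Q K mat_adjoint_mult[OF P Q(1)]
    by (simp add: K_def assoc_mult_mat[of _ n n _ m _ n] assoc_mult_mat[of _ n m _ n _ n])
  also have "\<dots> = (mat_adjoint Q * Q) * mat_diag n (\<lambda>i. of_real (s i) * of_real (s i))"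
    unfolding KQ using Q by (simp add: assoc_mult_mat[of _ n n _ n _ n])
  also have "\<dots> = mat_diag n (\<lambda>i. of_real (s i) * of_real (s i))"
    unfolding QQ by (rule left_mult_one_mat) (rule mat_diag_dim)
  finally have gram: "mat_adjoint (P * Q) * (P * Q) = mat_diag n (\<lambda>i. of_real (s i) * of_real (s i))" .
  have ww: "w j \<bullet>c w i = (if i = j then of_real (s i) * of_real (s i) else 0)"
    if ij: "i < n" "j < n" for i j
  proof -
    have "(mat_adjoint (P * Q) * (P * Q)) $$ (i, j) = row (mat_adjoint (P * Q)) i \<bullet> w j"
      unfolding w_def by (rule index_mult_mat(1)) (use P Q ij in auto)
    also have "row (mat_adjoint (P * Q)) i = conjugate (w i)"
      unfolding w_def by (rule eq_vecI) (use P Q ij in auto)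
    also have "conjugate (w i) \<bullet> w j = w j \<bullet>c w i"
      by (rule comm_scalar_prod[of _ m]) (use wc ij in auto)
    finally show ?thesis
      using ij unfolding gram by (auto simp: mat_diag_def)
  qed
  define I where "I = {i. i < n \<and> s i \<noteq> 0}"
  have "orthonormal_on I m (\<lambda>i. of_real (1 / s i) \<cdot>\<^sub>v w i)"
  proof -
    have "(of_real (1 / s j) \<cdot>\<^sub>v w j) \<bullet>c (of_real (1 / s i) \<cdot>\<^sub>v w i)
        = (if i = j then 1 else 0)" if ij: "i \<in> I" "j \<in> I" for i j
    proof -
      have c: "w i \<in> carrier_vec m" "w j \<in> carrier_vec m" and lt: "i < n" "j < n"
        and nz: "s i \<noteq> 0"
        using ij wc by (auto simp: I_def)
      have "(of_real (1 / s j) \<cdot>\<^sub>v w j) \<bullet>c (of_real (1 / s i) \<cdot>\<^sub>v w i)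
          = of_real (1 / s j) * (of_real (1 / s i) * (w j \<bullet>c w i))"
        using c by (simp add: conjugate_smult_vec)
      thus ?thesis unfolding ww[OF lt] using nz by (cases "i = j") auto
    qed
    thus ?thesis using wc by (auto simp: orthonormal_on_def I_def)
  qed
  then obtain v where v: "orthonormal_on {..<n} m v"
    and vI: "\<And>i. i \<in> I \<Longrightarrow> v i = of_real (1 / s i) \<cdot>\<^sub>v w i"
    using orthonormal_on_extend[of "{..<n}" I m] nm by (auto simp: I_def)
  have vc: "v i \<in> carrier_vec m" if "i < n" for i
    using v that by (auto simp: orthonormal_on_def)
  \<comment> \<open>Where \<open>s i = 0\<close> the column \<open>w i\<close> is zero, as is \<open>s i\<close> times whatever vector the extension chose.\<close>
  have wv: "w i = of_real (s i) \<cdot>\<^sub>v v i" if i: "i < n" for i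
  proof (cases "s i = 0")
    case True
    hence "w i = 0\<^sub>v m"
      using ww[OF i i] wc[OF i] by simp
    thus ?thesis using True vc[OF i] by (auto intro!: eq_vecI)
  next
    case False
    thus ?thesis using vI[of i] i wc[OF i] by (auto simp: I_def smult_smult_assoc intro!: eq_vecI)
  qed
  define W where "W = mat_of_family m n v"
  have W: "W \<in> carrier_mat m n" by (simp add: W_def)
  have isoW: "isometry_mat W"
    unfolding W_def by (rule orthonormal_on_isometry[OF v nm])
  define D where "D = mat_diag n (\<lambda>i. of_real (s i) :: complex)"
  have D: "D \<in> carrier_mat n n" by (simp add: D_def)
  have PQ: "P * Q = W * D"
  proof (rule eq_matI)
    fix i j assume "i < dim_row (W * D)" "j < dim_col (W * D)"
    hence ij: "i < m" "j < n" using W D by auto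
    have "(P * Q) $$ (i, j) = w j $ i"
      using ij P Q by (auto simp: w_def)
    also have "\<dots> = (W * D) $$ (i, j)"
      unfolding D_def using ij wv[OF ij(2)] vc[OF ij(2)]
      by (subst mat_diag_mult_right[OF W]) (auto simp: W_def mat_of_family_def)
    finally show "(P * Q) $$ (i, j) = (W * D) $$ (i, j)" .
  qed (use P Q W D in auto)
  define U where "U = W * mat_adjoint Q"
  define T where "T = Q * D * mat_adjoint Q"
  have "U * T = W * ((mat_adjoint Q * Q) * (D * mat_adjoint Q))"
    using W Q D
    by (simp add: U_def T_def assoc_mult_mat[of _ m n _ n _ n] assoc_mult_mat[of _ n n _ n _ n])
  also have "\<dots> = (P * Q) * mat_adjoint Q"
    unfolding QQ PQ using W Q D by (simp add: assoc_mult_mat[of _ m n _ n _ n])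
  also have "\<dots> = P"
    using P Q QQ by (simp add: assoc_mult_mat[of _ m n _ n _ n])
  finally have "P = U * T" by simp
  moreover have "isometry_mat U"
    unfolding U_def by (rule isometry_mat_mult_unitary[OF W Q(1) isoW Q(2)])
  moreover have "mat_adjoint T = T"
    unfolding T_def D_def
    by (rule mat_adjoint_conjugation[OF Q(1)]) (auto simp: mat_adjoint_diag_real)
  ultimately show thesis
    using that[of U T] W Q(1) D unfolding U_def T_def
    by (meson mult_carrier_mat mat_adjoint_carrier)
qed

text \<open>
  With \<open>P = U T\<close> the left side is \<open>U T\<^sup>2 U\<^sup>*\<close>, and \<open>P\<^sup>* P = T U\<^sup>* U T = T\<^sup>2\<close>.
\<close>

lemma gram_exchange:
  assumes P: "P \<in> carrier_mat m n" and nm: "n \<le> m"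
  obtains U where "U \<in> carrier_mat m n" "isometry_mat U"
    "P * mat_adjoint P = U * (mat_adjoint P * P) * mat_adjoint U"
proof -
  obtain U T where U: "U \<in> carrier_mat m n" "isometry_mat U"
    and T: "T \<in> carrier_mat n n" "mat_adjoint T = T" and PUT: "P = U * T"
    using polar_decomposition[OF P nm] by metis
  have UU: "mat_adjoint U * U = 1\<^sub>m n"
    using U by (auto simp: isometry_mat_def)
  have ad: "mat_adjoint P = T * mat_adjoint U"
    using mat_adjoint_mult[OF U(1) T(1)] T PUT by simp
  have "mat_adjoint P * P = T * ((mat_adjoint U * U) * T)"
    unfolding ad unfolding PUT using U T
    by (simp add: assoc_mult_mat[of _ n n _ m _ n] assoc_mult_mat[of _ n m _ n _ n])
  hence PP: "mat_adjoint P * P = T * T"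
    unfolding UU using T by simp
  have "P * mat_adjoint P = U * (T * T) * mat_adjoint U"
    unfolding ad unfolding PUT using U T
    by (simp add: assoc_mult_mat[of _ m n _ n _ m] assoc_mult_mat[of _ n n _ n _ m]
        assoc_mult_mat[of _ m n _ n _ n])
  thus thesis using that[OF U] PP by simp
qed

section \<open>The two compressions\<close>

text \<open>
  The right-hand blocks have no columns; they make this \<open>2n \<times> n\<close> matrix an instance of the block
  calculus.  The columns are orthogonal with norm \<open>\<surd>2\<close> rather than \<open>1\<close> when \<open>\<bar>\<epsilon>\<bar> = 1\<close>: without the
  normalization the compression is exactly \<open>A + B\<close>.
\<close>

definition phase_col :: "nat \<Rightarrow> complex \<Rightarrow> complex mat" where
  "phase_col n \<epsilon> = four_block_mat (1\<^sub>m n) (0\<^sub>m n 0) (\<epsilon> \<cdot>\<^sub>m 1\<^sub>m n) (0\<^sub>m n 0)"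

lemma phase_col_carrier [simp]: "phase_col n \<epsilon> \<in> carrier_mat (2 * n) n"
  by (simp add: phase_col_def mult_2 carrier_matI)

lemma mat_adjoint_phase_col:
  "mat_adjoint (phase_col n \<epsilon>)
    = four_block_mat (1\<^sub>m n) (cnj \<epsilon> \<cdot>\<^sub>m 1\<^sub>m n) (0\<^sub>m 0 n) (0\<^sub>m 0 n)"
  by (rule eq_matI) (auto simp: phase_col_def)

text \<open>
  The product is \<open>A + \<epsilon> X + cnj \<epsilon> X + (\<epsilon> cnj \<epsilon>) B\<close>, and \<open>\<epsilon> + cnj \<epsilon> = 0\<close>, \<open>\<epsilon> cnj \<epsilon> = 1\<close>.
\<close>

lemma phase_col_compress:
  assumes A: "A \<in> carrier_mat n n" and B: "B \<in> carrier_mat n n" and X: "X \<in> carrier_mat n n"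
    and \<epsilon>: "\<epsilon> = \<i> \<or> \<epsilon> = - \<i>"
  shows "mat_adjoint (phase_col n \<epsilon>) * (four_block_mat A X X B * phase_col n \<epsilon>) = A + B"
proof -
  have 1: "four_block_mat A X X B * phase_col n \<epsilon>
     = four_block_mat (A * 1\<^sub>m n + X * (\<epsilon> \<cdot>\<^sub>m 1\<^sub>m n)) (A * 0\<^sub>m n 0 + X * 0\<^sub>m n 0)
         (X * 1\<^sub>m n + B * (\<epsilon> \<cdot>\<^sub>m 1\<^sub>m n)) (X * 0\<^sub>m n 0 + B * 0\<^sub>m n 0)"
    unfolding phase_col_def
    by (rule mult_four_block_mat[OF A X X B]) auto
  have 2: "A * 1\<^sub>m n + X * (\<epsilon> \<cdot>\<^sub>m 1\<^sub>m n) = A + \<epsilon> \<cdot>\<^sub>m X"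
    "X * 1\<^sub>m n + B * (\<epsilon> \<cdot>\<^sub>m 1\<^sub>m n) = X + \<epsilon> \<cdot>\<^sub>m B"
    using A B X by (auto simp: mult_smult_distrib[of _ n n])
  have 3: "A * 0\<^sub>m n 0 + X * 0\<^sub>m n 0 = 0\<^sub>m n 0" "X * 0\<^sub>m n 0 + B * 0\<^sub>m n 0 = 0\<^sub>m n 0"
    using A B X by auto
  have "mat_adjoint (phase_col n \<epsilon>) * (four_block_mat A X X B * phase_col n \<epsilon>)
     = four_block_mat (1\<^sub>m n * (A + \<epsilon> \<cdot>\<^sub>m X) + (cnj \<epsilon> \<cdot>\<^sub>m 1\<^sub>m n) * (X + \<epsilon> \<cdot>\<^sub>m B))
         (1\<^sub>m n * 0\<^sub>m n 0 + (cnj \<epsilon> \<cdot>\<^sub>m 1\<^sub>m n) * 0\<^sub>m n 0)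
         (0\<^sub>m 0 n * (A + \<epsilon> \<cdot>\<^sub>m X) + 0\<^sub>m 0 n * (X + \<epsilon> \<cdot>\<^sub>m B))
         (0\<^sub>m 0 n * 0\<^sub>m n 0 + 0\<^sub>m 0 n * 0\<^sub>m n 0)"
    unfolding mat_adjoint_phase_col 1 2 3
    by (rule mult_four_block_mat) (use A B X in auto)
  also have "\<dots> = A + B"
  proof -
    have a: "1\<^sub>m n * (A + \<epsilon> \<cdot>\<^sub>m X) + (cnj \<epsilon> \<cdot>\<^sub>m 1\<^sub>m n) * (X + \<epsilon> \<cdot>\<^sub>m B)
        = (A + \<epsilon> \<cdot>\<^sub>m X) + cnj \<epsilon> \<cdot>\<^sub>m (X + \<epsilon> \<cdot>\<^sub>m B)"
      using A B X by (simp add: mult_smult_assoc_mat[of _ n n _ n])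
    also have "\<dots> = A + B"
      using A B X \<epsilon> by (intro eq_matI) (auto simp: algebra_simps)
    finally have a: "1\<^sub>m n * (A + \<epsilon> \<cdot>\<^sub>m X) + (cnj \<epsilon> \<cdot>\<^sub>m 1\<^sub>m n) * (X + \<epsilon> \<cdot>\<^sub>m B) = A + B" .
    show ?thesis
      unfolding a using A B by (intro eq_matI) auto
  qed
  finally show ?thesis .
qed

text \<open>
  Changing the sign of \<open>\<epsilon>\<close> flips the off-diagonal blocks of \<open>C\<^sub>\<epsilon> C\<^sub>\<epsilon>\<^sup>*\<close>, so that they cancel in
  the sum; the diagonal blocks are identities because \<open>\<epsilon> cnj \<epsilon> = 1\<close>.
\<close>

lemma phase_col_resolution:
  "phase_col n \<i> * mat_adjoint (phase_col n \<i>) + phase_col n (- \<i>) * mat_adjoint (phase_col n (- \<i>))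
    = 2 \<cdot>\<^sub>m 1\<^sub>m (2 * n)"
proof -
  have *: "phase_col n \<epsilon> * mat_adjoint (phase_col n \<epsilon>)
    = four_block_mat (1\<^sub>m n) (cnj \<epsilon> \<cdot>\<^sub>m 1\<^sub>m n) (\<epsilon> \<cdot>\<^sub>m 1\<^sub>m n) ((\<epsilon> * cnj \<epsilon>) \<cdot>\<^sub>m 1\<^sub>m n)" for \<epsilon>
  proof -
    have "phase_col n \<epsilon> * mat_adjoint (phase_col n \<epsilon>)
      = four_block_mat (1\<^sub>m n * 1\<^sub>m n + 0\<^sub>m n 0 * 0\<^sub>m 0 n)
          (1\<^sub>m n * (cnj \<epsilon> \<cdot>\<^sub>m 1\<^sub>m n) + 0\<^sub>m n 0 * 0\<^sub>m 0 n)
          ((\<epsilon> \<cdot>\<^sub>m 1\<^sub>m n) * 1\<^sub>m n + 0\<^sub>m n 0 * 0\<^sub>m 0 n)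
          ((\<epsilon> \<cdot>\<^sub>m 1\<^sub>m n) * (cnj \<epsilon> \<cdot>\<^sub>m 1\<^sub>m n) + 0\<^sub>m n 0 * 0\<^sub>m 0 n)"
      unfolding mat_adjoint_phase_col unfolding phase_col_def
      by (rule mult_four_block_mat) auto
    moreover have "(\<epsilon> \<cdot>\<^sub>m 1\<^sub>m n) * (cnj \<epsilon> \<cdot>\<^sub>m 1\<^sub>m n) = (\<epsilon> * cnj \<epsilon>) \<cdot>\<^sub>m (1\<^sub>m n :: complex mat)"
      by (subst mult_smult_assoc_mat[of _ n n _ n]) (auto intro!: eq_matI)
    ultimately show ?thesis by simp
  qed
  show ?thesis
    unfolding * by (intro eq_matI) auto
qed

section \<open>The decomposition\<close>

theorem theorem2p2:
  fixes n :: nat and A B X :: "complex mat"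
  assumes "n \<ge> 1"
    and "A \<in> carrier_mat n n" and "B \<in> carrier_mat n n" and "X \<in> carrier_mat n n"
    and "hermitian_mat X"
    and "psd_mat (four_block_mat A X X B)"
  shows "\<exists>U \<in> carrier_mat (2 * n) n. \<exists>V \<in> carrier_mat (2 * n) n.
    isometry_mat U \<and> isometry_mat V \<and>
    four_block_mat A X X B =
      (1 / 2) \<cdot>\<^sub>m (U * (A + B) * mat_adjoint U + V * (A + B) * mat_adjoint V)"
proof -
  define N where "N = 2 * n"
  define H where "H = four_block_mat A X X B"
  have H: "H \<in> carrier_mat N N"
    using assms(2,3) by (auto simp: H_def N_def mult_2)
  obtain R where R: "R \<in> carrier_mat N N" "mat_adjoint R = R" "R * R = H"
    using psd_mat_sqrt[OF H] assms(6) unfolding H_def by blast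
  have C: "phase_col n \<epsilon> \<in> carrier_mat N n" for \<epsilon>
    by (simp add: N_def)
  define P where "P \<epsilon> = R * phase_col n \<epsilon>" for \<epsilon>
  have P: "P \<epsilon> \<in> carrier_mat N n" for \<epsilon>
    using R C by (simp add: P_def)
  have adP: "mat_adjoint (P \<epsilon>) = mat_adjoint (phase_col n \<epsilon>) * R" for \<epsilon>
    using mat_adjoint_mult[OF R(1) C] R by (simp add: P_def)
  have PP: "mat_adjoint (P \<epsilon>) * P \<epsilon> = A + B" if \<epsilon>: "\<epsilon> = \<i> \<or> \<epsilon> = - \<i>" for \<epsilon>
  proof -
    have "mat_adjoint (P \<epsilon>) * P \<epsilon> = mat_adjoint (phase_col n \<epsilon>) * ((R * R) * phase_col n \<epsilon>)"
      unfolding adP unfolding P_def using R(1) C[of \<epsilon>]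
      by (simp add: assoc_mult_mat[of _ n N _ N _ n] assoc_mult_mat[of _ N N _ N _ n])
    thus ?thesis
      using phase_col_compress[OF assms(2-4) \<epsilon>] unfolding R(3) H_def by simp
  qed
  have CR: "mat_adjoint (phase_col n \<epsilon>) * R \<in> carrier_mat n N" for \<epsilon>
    by (rule mult_carrier_mat[OF mat_adjoint_carrier[OF C] R(1)])
  have split: "P \<epsilon> * mat_adjoint (P \<epsilon>) = R * (phase_col n \<epsilon> * mat_adjoint (phase_col n \<epsilon>)) * R" for \<epsilon>
    unfolding adP unfolding P_def using R(1) C[of \<epsilon>] CR[of \<epsilon>]
    by (simp add: assoc_mult_mat[of _ N n _ N _ N] assoc_mult_mat[of _ N N _ n _ N]
        assoc_mult_mat[of _ N N _ N _ N])
  have CC: "phase_col n \<epsilon> * mat_adjoint (phase_col n \<epsilon>) \<in> carrier_mat N N" for \<epsilon>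
    using C[of \<epsilon>] by simp
  have "P \<i> * mat_adjoint (P \<i>) + P (- \<i>) * mat_adjoint (P (- \<i>))
      = R * (phase_col n \<i> * mat_adjoint (phase_col n \<i>)
             + phase_col n (- \<i>) * mat_adjoint (phase_col n (- \<i>))) * R"
    unfolding split using R(1) CC[of \<i>] CC[of "- \<i>"]
    by (simp add: add_mult_distrib_mat[of _ N N _ _ N] mult_add_distrib_mat[of _ N N _ N])
  also have "\<dots> = 2 \<cdot>\<^sub>m H"
    unfolding phase_col_resolution N_def[symmetric] R(3)[symmetric] using R(1)
    by (simp add: mult_smult_distrib[of _ N N _ N] mult_smult_assoc_mat[of _ N N _ N])
  finally have sum: "P \<i> * mat_adjoint (P \<i>) + P (- \<i>) * mat_adjoint (P (- \<i>)) = 2 \<cdot>\<^sub>m H" .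
  have nN: "n \<le> N" by (simp add: N_def)
  obtain U where U: "U \<in> carrier_mat N n" "isometry_mat U"
    "P \<i> * mat_adjoint (P \<i>) = U * (A + B) * mat_adjoint U"
    using gram_exchange[OF P[of \<i>] nN] PP[of \<i>] by metis
  obtain V where V: "V \<in> carrier_mat N n" "isometry_mat V"
    "P (- \<i>) * mat_adjoint (P (- \<i>)) = V * (A + B) * mat_adjoint V"
    using gram_exchange[OF P[of "- \<i>"] nN] PP[of "- \<i>"] by metis
  have "(1 / 2) \<cdot>\<^sub>m (U * (A + B) * mat_adjoint U + V * (A + B) * mat_adjoint V) = (1 / 2) \<cdot>\<^sub>m (2 \<cdot>\<^sub>m H)"
    using sum U(3) V(3) by simp
  also have "\<dots> = H"
    by (rule eq_matI) auto
  finally show ?thesis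
    using U(1,2) V(1,2) unfolding H_def N_def by metis
qed

end
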